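(* Let $k \geq 1$ be an integer. Arrange the Chebyshev polynomials of the first kind $T_0(x), T_1(x), T_2(x), \dots$ in a table whose row $n$ ($n\ge 0$) lists the terms of $T_n(x)$ in descending powers of $x$, with column $j$ ($j \geq 0$) of row $n$ containing the $x^{n-2j}$ term. Then the sums of coefficients along the lines of slope $k-1$ in this table are the $k$-step Fibonacci numbers. Explicitly, for every integer $n \geq 0$, $$\sum_{\substack{j \geq 0 \\ (k+1)j \leq n}} [x^{\,n-(k+1)j}]\, T_{n-(k-1)j}(x) \;=\; F_{n+1}^{(k)},$$ where $[x^m]\,p(x)$ denotes the coefficient of $x^m$ in the polynomial $p(x)$.
   Context: The Chebyshev polynomials of the first kind are defined by $T_0(x)=1$, $T_1(x)=x$, and $T_n(x)=2x\,T_{n-1}(x)-T_{n-2}(x)$ for $n\geq 2$. For $k\geq 1$, the $k$-step Fibonacci numbers $F_n^{(k)}$ ($n\in\mathbb{Z}$) are defined by $F_n^{(k)}=0$ if $n\leq 0$, $F_1^{(k)}=1$, and $F_n^{(k)}=F_{n-1}^{(k)}+F_{n-2}^{(k)}+\cdots+F_{n-k}^{(k)}$ if $n\geq 2$. Table convention: rows are indexed from top to bottom by $n=0,1,2,\dots$ and columns from left to right by $j=0,1,2,\dots$; the entry in row $n$ and column $j$ is the $x^{n-2j}$ term of $T_n(x)$ when $2j\leq n$, and is empty otherwise. The line of slope $k-1$ starting at row $n$ of column $0$ passes through the positions (row $n-(k-1)j$, column $j$) for $j=0,1,2,\dots$, i.e. it rises $k-1$ rows for each step of one column to the right; empty positions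 contribute $0$. *)

theory Defs
  imports "HOL-Computational_Algebra.Polynomial"
begin

fun chebyshev_T :: "nat \<Rightarrow> int poly" where
  "chebyshev_T 0 = 1"
| "chebyshev_T (Suc 0) = [:0, 1:]"
| "chebyshev_T (Suc (Suc n)) = 2 * [:0, 1:] * chebyshev_T (Suc n) - chebyshev_T n"

function step_fib :: "nat \<Rightarrow> int \<Rightarrow> int" where
  "step_fib k n =
     (if n \<le> 0 then 0 else if n = 1 then 1 else (\<Sum>i = 1..k. step_fib k (n - int i)))"
  by auto
termination
  by (relation "measure (\<lambda>(k, n). nat n)") auto

declare step_fib.simps [simp del]

definition table_positions :: "(nat \<times> nat) set" where
  "table_positions = {(r, j). 2 * j \<le> r}"

definition table_coeff :: "nat \<times> nat \<Rightarrow> int" where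
  "table_coeff = (\<lambda>(r, j). coeff (chebyshev_T r) (r - 2 * j))"

text \<open>The line of slope \<open>s\<close> through row \<open>n\<close> of column \<open>0\<close>. The row is \<open>r = n - s * j\<close>, written
  without subtraction so that positions above row \<open>0\<close> are left out; these are empty anyway.\<close>

definition slope_line :: "nat \<Rightarrow> nat \<Rightarrow> (nat \<times> nat) set" where
  "slope_line s n = {(r, j). r + s * j = n}"

end

(* Both sides satisfy a(n) = 2 a(n - 1) - a(n - k - 1) for n \<ge> 2. For the Fibonacci numbers this
   is the difference of two consecutive instances of the defining recurrence. On the table side,
   write m = n - (k + 1) j for the exponent, so that the row is m + 2 j: the factor 2 x in the
   Chebyshev recurrence lowers m by one and fixes j, that is, moves to the line through n - 1, and
   the subtracted term fixes m and lowers j by one, that is, moves to the line through n - k - 1. *)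
theory Submission
  imports Defs
begin

lemma step_fib_nonpos: "n \<le> 0 \<Longrightarrow> step_fib k n = 0"
  by (simp add: step_fib.simps)

lemma step_fib_one: "step_fib k 1 = 1"
  by (simp add: step_fib.simps)

lemma step_fib_rec: "n \<ge> 2 \<Longrightarrow> step_fib k n = (\<Sum>i = 1..k. step_fib k (n - int i))"
  by (subst step_fib.simps) simp

lemma step_fib_two:
  assumes "k \<ge> 1"
  shows "step_fib k 2 = 1"
proof -
  have "step_fib k 2 = (\<Sum>i = 1..k. step_fib k (2 - int i))"
    by (simp add: step_fib_rec)
  also have "\<dots> = (\<Sum>i = 1..k. if i = 1 then 1 else 0)"
    by (intro sum.cong) (auto simp: step_fib_nonpos step_fib_one)
  finally show ?thesis
    using assms by simp
qed

text \<open>Passing from n to n + 1 shifts the window of k summands: it gains the value at n and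
  loses the one at n - k. At n = 1 the formula fails, because \<open>step_fib k 1\<close> is set to
  1 and is not a window sum; hence \<open>step_fib_two\<close> as a separate start value.\<close>

lemma step_fib_double:
  assumes "n \<ge> 2"
  shows "step_fib k (n + 1) = 2 * step_fib k n - step_fib k (n - int k)"
proof -
  have shift: "(\<Sum>i<m. f i) = f 0 + (\<Sum>i = 1..m. f i) - f m" for m and f :: "nat \<Rightarrow> int"
    by (induction m) simp_all
  have "step_fib k (n + 1) = (\<Sum>i = 1..k. step_fib k (n + 1 - int i))"
    using assms by (simp add: step_fib_rec)
  also have "\<dots> = (\<Sum>i<k. step_fib k (n - int i))"
    by (rule sum.reindex_bij_witness[of _ Suc "\<lambda>i. i - 1"]) (auto simp: of_nat_diff algebra_simps)
  also have "\<dots> = step_fib k n + (\<Sum>i = 1..k. step_fib k (n - int i)) - step_fib k (n - int k)"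
    using shift[of "\<lambda>i. step_fib k (n - int i)" k] by simp
  finally show ?thesis
    using assms by (simp add: step_fib_rec[of n])
qed

lemma degree_chebyshev_T: "degree (chebyshev_T n) \<le> n"
proof (induction n rule: chebyshev_T.induct)
  case (3 n)
  have "degree (2 * [:0, 1:] * chebyshev_T (Suc n)) \<le> Suc (Suc n)"
    using degree_mult_le[of "2 * [:0, 1:]" "chebyshev_T (Suc n)"] 3 by (simp add: numeral_poly)
  with 3 show ?case
    by (auto intro!: degree_diff_le)
qed auto

lemma coeff_chebyshev_T_0: "coeff (chebyshev_T (Suc (Suc n))) 0 = - coeff (chebyshev_T n) 0"
  by (simp add: numeral_poly)

lemma coeff_chebyshev_T_Suc:
  "coeff (chebyshev_T (Suc (Suc n))) (Suc m) =
     2 * coeff (chebyshev_T (Suc n)) m - coeff (chebyshev_T n) (Suc m)"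
  by (simp add: numeral_poly)

text \<open>The row is written as exponent plus 2 j, so that both terms of the Chebyshev recurrence
  can be read off and the truncated k - 1 does not occur.\<close>

definition line_sum :: "nat \<Rightarrow> nat \<Rightarrow> int" where
  "line_sum k n = (\<Sum>j | (k + 1) * j \<le> n.
     coeff (chebyshev_T (n - (k + 1) * j + 2 * j)) (n - (k + 1) * j))"

lemma finite_multiples_le: "finite {j. (k + 1) * j \<le> (n::nat)}"
  by (rule finite_subset[of _ "{..n}"]) auto

lemma row_eq:
  assumes "k \<ge> 1" "(k + 1) * j \<le> (n::nat)"
  shows "n - (k - 1) * j = n - (k + 1) * j + 2 * j"
proof -
  have "(k - 1) * j + 2 * j = (k + 1) * j"
    using assms(1) by (simp flip: add_mult_distrib)
  with assms(2) show ?thesis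
    by linarith
qed

text \<open>As k + 1 \<ge> 2, such a line meets only column 0, where it picks the leading
  coefficient of T_0 or T_1.\<close>

lemma line_sum_less_two:
  assumes "k \<ge> 1" "n < 2"
  shows "line_sum k n = 1"
proof -
  have "{j. (k + 1) * j \<le> n} = {0}"
  proof -
    have "j = 0" if "(k + 1) * j \<le> n" for j
    proof (cases j)
      case (Suc i)
      then have "2 * 1 \<le> (k + 1) * j"
        using assms(1) by (intro mult_le_mono) simp_all
      with that assms(2) show ?thesis by linarith
    qed simp
    then show ?thesis by auto
  qed
  moreover have "n = 0 \<or> n = Suc 0" using assms by auto
  ultimately show ?thesis
    unfolding line_sum_def by (elim disjE) (simp_all only:, simp_all)
qed

lemma line_sum_rec:
  assumes "k \<ge> 1"
  shows "line_sum k (Suc (Suc n)) =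
    2 * line_sum k (Suc n) - (if k \<le> Suc n then line_sum k (Suc n - k) else 0)"
proof -
  let ?N = "Suc (Suc n)"
  let ?J = "\<lambda>N. {j. (k + 1) * j \<le> N}"
  let ?m = "\<lambda>N j. N - (k + 1) * j"
  \<comment> \<open>The two parts of the Chebyshev recurrence at column j. The zero cases stop
    truncated subtraction from inventing terms: \<open>a\<close> vanishes at exponent 0, which the
    factor 2 x cannot reach, and \<open>b\<close> vanishes in column 0, which has no column to its
    left.\<close>
  define a where "a j = (if (k + 1) * j \<le> Suc n
    then coeff (chebyshev_T (?m (Suc n) j + 2 * j)) (?m (Suc n) j) else 0)" for j
  define b where "b j = (if j = 0 then 0
    else coeff (chebyshev_T (?m ?N j + 2 * (j - 1))) (?m ?N j))" for j
  have term_rec: "coeff (chebyshev_T (?m ?N j + 2 * j)) (?m ?N j) = 2 * a j - b j"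
    if j: "(k + 1) * j \<le> ?N" for j
  proof (cases "(k + 1) * j \<le> Suc n")
    case le: True
    then have m: "?m ?N j = Suc (?m (Suc n) j)"
      by (simp add: Suc_diff_le)
    show ?thesis
    proof (cases j)
      case 0
      \<comment> \<open>In column 0 the subtracted term has exponent n + 2, above the degree of
        T_n.\<close>
      have "coeff (chebyshev_T n) ?N = 0"
        using degree_chebyshev_T[of n] by (intro coeff_eq_0) simp
      then show ?thesis
        using 0 coeff_chebyshev_T_Suc[of n "Suc n"] by (simp add: a_def b_def)
    next
      case (Suc i)
      have "?m ?N j + 2 * j = Suc (Suc (?m ?N j + 2 * i))"
        "Suc (?m ?N j + 2 * i) = ?m (Suc n) j + 2 * j"
        using m Suc by simp_all
      then have "coeff (chebyshev_T (?m ?N j + 2 * j)) (?m ?N j) =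
        2 * coeff (chebyshev_T (?m (Suc n) j + 2 * j)) (?m (Suc n) j)
          - coeff (chebyshev_T (?m ?N j + 2 * i)) (?m ?N j)"
        using coeff_chebyshev_T_Suc[of "?m ?N j + 2 * i" "?m (Suc n) j"] m by metis
      then show ?thesis
        using le Suc by (simp only: a_def b_def if_True) simp
    qed
  next
    case False
    with j have eq: "(k + 1) * j = ?N" by linarith
    then obtain i where i: "j = Suc i" by (cases j) auto
    have "a j = 0" using False by (simp add: a_def)
    moreover have "b j = coeff (chebyshev_T (2 * i)) 0"
      unfolding b_def eq by (simp add: i)
    moreover have "coeff (chebyshev_T (?m ?N j + 2 * j)) (?m ?N j) = - coeff (chebyshev_T (2 * i)) 0"
      unfolding eq using coeff_chebyshev_T_0[of "2 * i"] i by (simp del: chebyshev_T.simps)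
    ultimately show ?thesis by simp
  qed
  have "line_sum k ?N = (\<Sum>j\<in>?J ?N. 2 * a j - b j)"
    unfolding line_sum_def by (intro sum.cong refl term_rec) simp
  also have "\<dots> = 2 * sum a (?J ?N) - sum b (?J ?N)"
    by (simp add: sum_subtractf sum_distrib_left)
  \<comment> \<open>The only possible extra index has (k + 1) j = n + 2, where \<open>a\<close> is
    0.\<close>
  also have "sum a (?J ?N) = sum a (?J (Suc n))"
    by (rule sum.mono_neutral_right[OF finite_multiples_le]) (auto simp: a_def)
  also have "\<dots> = line_sum k (Suc n)"
    unfolding line_sum_def by (intro sum.cong) (auto simp: a_def)
  also have "sum b (?J ?N) = sum b (?J ?N - {0})"
    by (rule sum.mono_neutral_right[OF finite_multiples_le]) (auto simp: b_def)
  also have "\<dots> = (if k \<le> Suc n then line_sum k (Suc n - k) else 0)"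
  proof (cases "k \<le> Suc n")
    case True
    \<comment> \<open>Moving one column left lowers the start of the line by k + 1, from n + 2 to n
      + 1 - k.\<close>
    have shift: "(k + 1) * Suc i \<le> ?N \<longleftrightarrow> (k + 1) * i \<le> Suc n - k"
      "?m ?N (Suc i) = ?m (Suc n - k) i" for i
      using True unfolding mult_Suc_right by linarith+
    have "sum b (?J ?N - {0}) = line_sum k (Suc n - k)"
      unfolding line_sum_def
    proof (rule sum.reindex_bij_witness[of _ Suc "\<lambda>j. j - 1"])
      fix j assume j: "j \<in> ?J ?N - {0}"
      then obtain i where i: "j = Suc i" by (cases j) auto
      show "Suc (j - 1) = j" using i by simp
      show "j - 1 \<in> ?J (Suc n - k)"
        using j shift(1)[of i] unfolding i by simp
      show "coeff (chebyshev_T (?m (Suc n - k) (j - 1) + 2 * (j - 1))) (?m (Suc n - k) (j - 1)) = b j"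
        unfolding b_def i shift(2) by simp
    next
      fix i assume "i \<in> ?J (Suc n - k)"
      then show "Suc i \<in> ?J ?N - {0}" using shift(1)[of i] by simp
    qed simp
    with True show ?thesis by simp
  next
    case False
    \<comment> \<open>Here k + 1 > n + 2, so the line ends in column 0.\<close>
    have "?J ?N - {0} = {}"
    proof -
      have False if "(k + 1) * Suc i \<le> ?N" for i
        using that False unfolding mult_Suc_right by linarith
      then show ?thesis
        by (metis (no_types, lifting) Diff_iff equals0I insertI1 mem_Collect_eq not0_implies_Suc
            singleton_iff)
    qed
    with False show ?thesis by (simp only: sum.empty if_False)
  qed
  finally show ?thesis .
qed

lemma line_sum_eq_step_fib:
  assumes "k \<ge> 1"
  shows "line_sum k n = step_fib k (int n + 1)"
proof (induction n rule: less_induct)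
  case (less n)
  consider "n = 0" | "n = Suc 0" | m where "n = Suc (Suc m)"
    by (metis not0_implies_Suc)
  then show ?case
  proof cases
    case 1
    then show ?thesis
      using line_sum_less_two[OF assms, of 0] step_fib_one by simp
  next
    case 2
    then show ?thesis
      using line_sum_less_two[OF assms, of 1] step_fib_two[OF assms] by simp
  next
    case 3
    \<comment> \<open>The else case means n - k \<le> 0, where the Fibonacci numbers vanish as
      well.\<close>
    have "(if k \<le> Suc m then line_sum k (Suc m - k) else 0) = step_fib k (int n - int k)"
      using less.IH[of "Suc m - k"] 3 assms
      by (auto simp: of_nat_diff step_fib_nonpos algebra_simps)
    moreover have "line_sum k (Suc m) = step_fib k (int n)"
      using less.IH[of "Suc m"] 3 by (simp add: algebra_simps)
    ultimately show ?thesis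
      using line_sum_rec[OF assms, of m] step_fib_double[of "int n" k] 3 by simp
  qed
qed

theorem theorem1:
  fixes k n :: nat
  assumes "k \<ge> 1"
  shows "(\<Sum>p \<in> slope_line (k - 1) n \<inter> table_positions. table_coeff p) = step_fib k (int n + 1) \<and>
         (\<Sum>j | (k + 1) * j \<le> n. coeff (chebyshev_T (n - (k - 1) * j)) (n - (k + 1) * j))
          = step_fib k (int n + 1)"
proof -
  let ?J = "{j. (k + 1) * j \<le> n}"
  \<comment> \<open>For r = n - (k - 1) j this turns the table condition 2 j \<le> r into (k + 1) j
    \<le> n, and r - 2 j into the exponent n - (k + 1) j.\<close>
  have split: "Suc k * j = (k - Suc 0) * j + 2 * j" for j
    using assms by (simp flip: add_mult_distrib del: mult_Suc)
  have "(\<Sum>j\<in>?J. coeff (chebyshev_T (n - (k - 1) * j)) (n - (k + 1) * j)) = line_sum k n"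
    unfolding line_sum_def by (intro sum.cong refl) (metis assms mem_Collect_eq row_eq)
  moreover have "(\<Sum>p \<in> slope_line (k - 1) n \<inter> table_positions. table_coeff p) =
      (\<Sum>j\<in>?J. coeff (chebyshev_T (n - (k - 1) * j)) (n - (k + 1) * j))"
    by (rule sum.reindex_bij_witness[of _ "\<lambda>j. (n - (k - 1) * j, j)" snd])
      (auto simp: slope_line_def table_positions_def table_coeff_def split
        simp del: mult_Suc)
  ultimately show ?thesis
    using line_sum_eq_step_fib[OF assms] by simp
qed

end
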